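(* Let $\varphi$ be an analytic function on the unit disk $\mathbb{D}$ with $\sup_{z\in\mathbb{D}}|\varphi(z)|\le 1$. Then $$K^{\varphi}_w(z)=\frac{1-\varphi(z)\overline{\varphi(w)}}{(1-z\overline w)^{2}},\qquad z,w\in\mathbb{D},$$ is a complete Nevanlinna-Pick (CNP) kernel on $\mathbb{D}$ if and only if $\varphi$ is a Möbius map.
   Context: A Möbius map is a function of the form $\zeta\,\frac{a-z}{1-\overline a z}$ with $|\zeta|=1$ and $a\in\mathbb{D}$. CNP kernel: a positive semidefinite kernel $K(z,w)=K_w(z)$ on a set $\Omega$ that is irreducible (meaning here $K(z,w)\ne0$ for all $z,w\in\Omega$) is called a CNP kernel if there are a Hilbert space $\mathcal{L}$, a function $b:\Omega\to\mathcal{L}$ with $\|b(z)\|<1$ for all $z$, and a nowhere vanishing function $\delta:\Omega\to\mathbb{C}$ such that $$K_w(z)=\frac{\delta(z)\overline{\delta(w)}}{1-\langle b(z),b(w)\rangle},\qquad z,w\in\Omega.$$ (The kernel $K^\varphi_w(z)$ is positive semidefinite; it is the reproducing kernel of the sub-Bergman space, the range of $(I-T_\varphi T_\varphi^* )^{1/2}$ on the unweighted Bergman space $A^2$ of $\mathbb{D}$, where $T_\varphi$ is multiplication by $\varphi$.) *)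

theory Defs
  imports "HOL-Complex_Analysis.Complex_Analysis"
begin

section \<open>Complex Hilbert spaces\<close>

text \<open>
  The distribution only has real inner product spaces. Complex ones are given here by an explicit
  carrier, because the definition of a CNP kernel quantifies existentially over Hilbert spaces.
  The inner product is linear in its first argument.
\<close>

locale complex_inner_space =
  fixes H :: "'v set"
    and zero :: 'v
    and add :: "'v \<Rightarrow> 'v \<Rightarrow> 'v"
    and scal :: "complex \<Rightarrow> 'v \<Rightarrow> 'v"
    and inn :: "'v \<Rightarrow> 'v \<Rightarrow> complex"
  assumes zero_closed: "zero \<in> H"
    and add_closed: "\<lbrakk>x \<in> H; y \<in> H\<rbrakk> \<Longrightarrow> add x y \<in> H"
    and scale_closed: "x \<in> H \<Longrightarrow> scal c x \<in> H"
    and add_assoc: "\<lbrakk>x \<in> H; y \<in> H; z \<in> H\<rbrakk> \<Longrightarrow> add (add x y) z = add x (add y z)"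
    and add_commute: "\<lbrakk>x \<in> H; y \<in> H\<rbrakk> \<Longrightarrow> add x y = add y x"
    and add_zero: "x \<in> H \<Longrightarrow> add zero x = x"
    and add_inverse: "x \<in> H \<Longrightarrow> add x (scal (- 1) x) = zero"
    and scale_one: "x \<in> H \<Longrightarrow> scal 1 x = x"
    and scale_scale: "x \<in> H \<Longrightarrow> scal c (scal d x) = scal (c * d) x"
    and scale_add_right: "\<lbrakk>x \<in> H; y \<in> H\<rbrakk> \<Longrightarrow> scal c (add x y) = add (scal c x) (scal c y)"
    and scale_add_left: "x \<in> H \<Longrightarrow> scal (c + d) x = add (scal c x) (scal d x)"
    and inn_add: "\<lbrakk>x \<in> H; y \<in> H; z \<in> H\<rbrakk> \<Longrightarrow> inn (add x y) z = inn x z + inn y z"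
    and inn_scale: "\<lbrakk>x \<in> H; y \<in> H\<rbrakk> \<Longrightarrow> inn (scal c x) y = c * inn x y"
    and inn_commute: "\<lbrakk>x \<in> H; y \<in> H\<rbrakk> \<Longrightarrow> inn y x = cnj (inn x y)"
    and inn_nonneg: "x \<in> H \<Longrightarrow> inn x x \<in> \<real>\<^sub>\<ge>\<^sub>0"
    and inn_definite: "\<lbrakk>x \<in> H; inn x x = 0\<rbrakk> \<Longrightarrow> x = zero"
begin

definition nrm :: "'v \<Rightarrow> real" where
  "nrm x = sqrt (Re (inn x x))"

definition dst :: "'v \<Rightarrow> 'v \<Rightarrow> real" where
  "dst x y = nrm (add x (scal (- 1) y))"

end

locale complex_hilbert_space = complex_inner_space +
  assumes complete:
    "\<lbrakk>\<And>n. X n \<in> H; \<And>e. e > 0 \<Longrightarrow> \<exists>N. \<forall>m\<ge>N. \<forall>n\<ge>N. dst (X m) (X n) < e\<rbrakk>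
      \<Longrightarrow> \<exists>l\<in>H. (\<lambda>n. dst (X n) l) \<longlonglongrightarrow> 0"


section \<open>Complete Nevanlinna-Pick kernels\<close>

text \<open>A kernel is written \<open>K z w\<close> for $K(z,w) = K_w(z)$.\<close>

definition psd_kernel :: "'a set \<Rightarrow> ('a \<Rightarrow> 'a \<Rightarrow> complex) \<Rightarrow> bool" where
  "psd_kernel \<Omega> K \<longleftrightarrow>
    (\<forall>F c. finite F \<and> F \<subseteq> \<Omega> \<longrightarrow> (\<Sum>z\<in>F. \<Sum>w\<in>F. cnj (c z) * c w * K z w) \<in> \<real>\<^sub>\<ge>\<^sub>0)"

definition irreducible_kernel :: "'a set \<Rightarrow> ('a \<Rightarrow> 'a \<Rightarrow> complex) \<Rightarrow> bool" where
  "irreducible_kernel \<Omega> K \<longleftrightarrow> (\<forall>z\<in>\<Omega>. \<forall>w\<in>\<Omega>. K z w \<noteq> 0)"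

definition cnp_representation ::
    "'a set \<Rightarrow> ('a \<Rightarrow> 'a \<Rightarrow> complex) \<Rightarrow> 'v set \<Rightarrow> ('v \<Rightarrow> 'v \<Rightarrow> complex) \<Rightarrow> ('a \<Rightarrow> 'v)
      \<Rightarrow> ('a \<Rightarrow> complex) \<Rightarrow> bool" where
  "cnp_representation \<Omega> K H inn b \<delta> \<longleftrightarrow>
    (\<forall>z\<in>\<Omega>. b z \<in> H \<and> complex_inner_space.nrm inn (b z) < 1 \<and> \<delta> z \<noteq> 0) \<and>
    (\<forall>z\<in>\<Omega>. \<forall>w\<in>\<Omega>. K z w = \<delta> z * cnj (\<delta> w) / (1 - inn (b z) (b w)))"

text \<open>
  HOL cannot quantify over types inside a formula, so the vectors of the Hilbert space below are
  elements of the type \<^typ>\<open>'a \<Rightarrow> complex\<close> (with arbitrary carrier and operations). This is no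
  restriction: lemma \<open>cnp_kernelI\<close> at the end of this theory shows that a representation in a
  Hilbert space over any type whatsoever suffices.
\<close>

definition cnp_kernel :: "'a set \<Rightarrow> ('a \<Rightarrow> 'a \<Rightarrow> complex) \<Rightarrow> bool" where
  "cnp_kernel \<Omega> K \<longleftrightarrow>
    psd_kernel \<Omega> K \<and> irreducible_kernel \<Omega> K \<and>
    (\<exists>(H :: ('a \<Rightarrow> complex) set) zero add scal inn b \<delta>.
        complex_hilbert_space H zero add scal inn \<and> cnp_representation \<Omega> K H inn b \<delta>)"


section \<open>Moebius maps and the kernels of sub-Bergman spaces\<close>

definition moebius_map :: "(complex \<Rightarrow> complex) \<Rightarrow> bool" where
  "moebius_map \<phi> \<longleftrightarrow>
    (\<exists>\<zeta> a. norm \<zeta> = 1 \<and> a \<in> ball 0 1 \<and> (\<forall>z\<in>ball 0 1. \<phi> z = \<zeta> * ((a - z) / (1 - cnj a * z))))"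

definition sub_bergman_kernel :: "(complex \<Rightarrow> complex) \<Rightarrow> complex \<Rightarrow> complex \<Rightarrow> complex" where
  "sub_bergman_kernel \<phi> z w = (1 - \<phi> z * cnj (\<phi> w)) / (1 - z * cnj w)\<^sup>2"


section \<open>Independence of the type of vectors\<close>

context complex_inner_space
begin

lemma zero_eq: "x \<in> H \<Longrightarrow> scal 0 x = zero"
proof -
  assume x: "x \<in> H"
  have "scal 0 x = scal (1 + (- 1)) x" by simp
  also have "\<dots> = zero" using x by (simp only: scale_add_left scale_one add_inverse)
  finally show ?thesis .
qed

lemma inn_add_right: "\<lbrakk>x \<in> H; y \<in> H; z \<in> H\<rbrakk> \<Longrightarrow> inn z (add x y) = inn z x + inn z y"
  using inn_commute[of "add x y" z] inn_commute[of x z] inn_commute[of y z]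
  by (simp add: inn_add add_closed)

lemma inn_scale_right: "\<lbrakk>x \<in> H; y \<in> H\<rbrakk> \<Longrightarrow> inn y (scal c x) = cnj c * inn y x"
  using inn_commute[of "scal c x" y] inn_commute[of x y] by (simp add: inn_scale scale_closed)

lemma inn_zero: "x \<in> H \<Longrightarrow> inn zero x = 0"
  using inn_scale[of x x 0] zero_eq[of x] by simp

lemma inn_self: "x \<in> H \<Longrightarrow> inn x x = of_real ((nrm x)\<^sup>2)"
  using inn_nonneg[of x] by (auto simp: nrm_def nonneg_Reals_def simp flip: of_real_power)

lemma nrm_nonneg: "x \<in> H \<Longrightarrow> 0 \<le> nrm x"
  using inn_nonneg[of x] by (auto simp: nrm_def nonneg_Reals_def)

lemma cauchy_schwarz:
  assumes x: "x \<in> H" and y: "y \<in> H"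
  shows "cmod (inn x y) \<le> nrm x * nrm y"
proof (cases "inn y y = 0")
  case True
  then have "y = zero" using y inn_definite by blast
  then have "inn x y = 0" using inn_commute[of y x] inn_zero[of x] x y by simp
  then show ?thesis using x y by (simp add: nrm_nonneg)
next
  case False
  define p where "p = (nrm y)\<^sup>2"
  have p: "inn y y = of_real p" using inn_self[OF y] by (simp add: p_def)
  have pp: "p > 0" using False p by (auto simp: p_def)
  define u where "u = add (scal (of_real p) x) (scal (- inn x y) y)"
  have u: "u \<in> H" using x y by (simp add: u_def add_closed scale_closed)
  have yx: "inn y x = cnj (inn x y)" using inn_commute x y by blast
  have "inn u u = of_real p * of_real p * inn x x - of_real p * (inn x y * cnj (inn x y))"
    unfolding u_def using x y
    by (simp add: inn_add inn_scale inn_add_right inn_scale_right add_closed scale_closed p yx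
        algebra_simps)
  also have "\<dots> = of_real (p * (p * (nrm x)\<^sup>2 - (cmod (inn x y))\<^sup>2))"
    by (simp add: inn_self[OF x] complex_norm_square[symmetric] algebra_simps
        del: of_real_power of_real_mult)
       (simp add: algebra_simps)
  finally have "p * (p * (nrm x)\<^sup>2 - (cmod (inn x y))\<^sup>2) \<ge> 0"
    using inn_nonneg[OF u] by (metis nonneg_Reals_of_real_iff)
  then have "(cmod (inn x y))\<^sup>2 \<le> (nrm x * nrm y)\<^sup>2"
    using pp by (simp add: zero_le_mult_iff p_def power_mult_distrib mult.commute)
  moreover have "0 \<le> nrm x * nrm y"
    using x y by (simp add: nrm_nonneg)
  ultimately show ?thesis by (rule power2_le_imp_le)
qed

lemma limit_orthogonal:
  assumes X: "\<And>n. X n \<in> H" and l: "l \<in> H" and u: "u \<in> H"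
    and lim: "(\<lambda>n. dst (X n) l) \<longlonglongrightarrow> 0" and orth: "\<And>n. inn (X n) u = 0"
  shows "inn l u = 0"
proof -
  have "cmod (inn l u) \<le> dst (X n) l * nrm u" for n
  proof -
    have "inn (add (X n) (scal (- 1) l)) u = - inn l u"
      using X l u orth by (simp add: inn_add inn_scale scale_closed)
    then show ?thesis
      unfolding dst_def
      using cauchy_schwarz[of "add (X n) (scal (- 1) l)" u] X l u
      by (simp add: add_closed scale_closed)
  qed
  moreover have "(\<lambda>n. dst (X n) l * nrm u) \<longlonglongrightarrow> 0 * nrm u"
    by (intro tendsto_mult lim tendsto_const)
  ultimately have "cmod (inn l u) \<le> 0"
    by (intro LIMSEQ_le_const) auto
  then show ?thesis by simp
qed

end

lemma hilbert_transport:
  fixes H :: "'v set" and T :: "'v \<Rightarrow> 'u"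
  assumes hilb: "complex_hilbert_space H zero add scal inn"
    and MH: "M \<subseteq> H" and M0: "zero \<in> M"
    and Madd: "\<And>x y. \<lbrakk>x \<in> M; y \<in> M\<rbrakk> \<Longrightarrow> add x y \<in> M"
    and Mscale: "\<And>c x. x \<in> M \<Longrightarrow> scal c x \<in> M"
    and Mclosed: "\<And>X l. \<lbrakk>\<And>n. X n \<in> M; l \<in> H;
        (\<lambda>n. complex_inner_space.dst add scal inn (X n) l) \<longlonglongrightarrow> 0\<rbrakk> \<Longrightarrow> l \<in> M"
    and JT: "\<And>x. x \<in> M \<Longrightarrow> J (T x) = x"
  shows "complex_hilbert_space (T ` M) (T zero) (\<lambda>f g. T (add (J f) (J g)))
    (\<lambda>c f. T (scal c (J f))) (\<lambda>f g. inn (J f) (J g))"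
proof -
  interpret complex_hilbert_space H zero add scal inn by (rule hilb)
  have inH: "x \<in> H" if "x \<in> M" for x using that MH by blast
  have inner: "complex_inner_space (T ` M) (T zero) (\<lambda>f g. T (add (J f) (J g)))
    (\<lambda>c f. T (scal c (J f))) (\<lambda>f g. inn (J f) (J g))"
  proof (unfold_locales, goal_cases)
    case (16 x)
    then show ?case using inH JT by (auto intro!: arg_cong[where f=T] inn_definite)
  next
    case (14 x y)
    then show ?case using inH JT by (auto intro!: inn_commute)
  qed (auto simp: JT M0 Madd Mscale inH add_assoc add_zero add_inverse scale_one scale_scale
      scale_add_right scale_add_left inn_add inn_scale inn_nonneg
      intro!: arg_cong[where f=T] add_commute)
  interpret N: complex_inner_space "T ` M" "T zero" "\<lambda>f g. T (add (J f) (J g))"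
    "\<lambda>c f. T (scal c (J f))" "\<lambda>f g. inn (J f) (J g)" by (rule inner)
  have dst: "N.dst f g = dst (J f) (J g)" if "f \<in> T ` M" "g \<in> T ` M" for f g
    using that by (auto simp: N.dst_def dst_def N.nrm_def nrm_def JT Madd Mscale)
  show ?thesis
  proof (unfold_locales, goal_cases)
    case (1 X)
    have JX: "J (X n) \<in> M" for n using 1(1)[of n] JT by auto
    have "\<exists>l\<in>H. (\<lambda>n. dst (J (X n)) l) \<longlonglongrightarrow> 0"
      by (rule complete) (use 1 JX inH dst in auto)
    then obtain l where l: "l \<in> H" "(\<lambda>n. dst (J (X n)) l) \<longlonglongrightarrow> 0" by blast
    then have "l \<in> M" using Mclosed[of "\<lambda>n. J (X n)" l] JX by blast
    then show ?case using l dst 1(1) JT by (intro bexI[of _ "T l"]) auto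
  qed
qed

lemma cnp_kernelI:
  fixes H :: "'v set" and K :: "'a \<Rightarrow> 'a \<Rightarrow> complex"
  assumes "psd_kernel \<Omega> K" and "irreducible_kernel \<Omega> K"
    and hilb: "complex_hilbert_space H zero add scal inn"
    and rep: "cnp_representation \<Omega> K H inn b \<delta>"
  shows "cnp_kernel \<Omega> K"
proof -
  interpret complex_hilbert_space H zero add scal inn by (rule hilb)
  have bH: "b z \<in> H" if "z \<in> \<Omega>" for z using that rep by (simp add: cnp_representation_def)
  define M where "M = {v \<in> H. \<forall>u\<in>H. (\<forall>z\<in>\<Omega>. inn u (b z) = 0) \<longrightarrow> inn v u = 0}"
  define T where "T = (\<lambda>v z. if z \<in> \<Omega> then inn v (b z) else 0)"
  define J where "J = inv_into M T"
  have bM: "b z \<in> M" if "z \<in> \<Omega>" for z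
    unfolding M_def
  proof (intro CollectI conjI ballI impI)
    show "b z \<in> H" by (rule bH[OF that])
    fix u assume "u \<in> H" and "\<forall>z\<in>\<Omega>. inn u (b z) = 0"
    then show "inn (b z) u = 0"
      using that inn_commute[of u "b z"] bH[OF that] by simp
  qed
  have inj: "inj_on T M"
  proof (rule inj_onI)
    fix x y assume xM: "x \<in> M" and yM: "y \<in> M" and eq: "T x = T y"
    define d where "d = add x (scal (- 1) y)"
    have x: "x \<in> H" and y: "y \<in> H" using xM yM by (auto simp: M_def)
    have d: "d \<in> H" using x y by (simp add: d_def add_closed scale_closed)
    have "inn d (b z) = 0" if "z \<in> \<Omega>" for z
      using fun_cong[OF eq, of z] that x y bH[OF that]
      by (simp add: T_def d_def inn_add inn_scale scale_closed)
    then have "inn x d = 0" and "inn y d = 0" using xM yM d by (auto simp: M_def)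
    then have "inn d d = 0"
      using x y d by (subst d_def) (simp add: inn_add inn_scale scale_closed)
    then have d0: "d = zero" using d inn_definite by blast
    have "x = add zero x" using x by (simp add: add_zero)
    also have "\<dots> = add x zero" using x zero_closed add_commute by blast
    also have "\<dots> = add x (add y (scal (- 1) y))" using y by (simp add: add_inverse)
    also have "\<dots> = add x (add (scal (- 1) y) y)"
      using y add_commute[of y "scal (- 1) y"] by (simp add: scale_closed)
    also have "\<dots> = add d y" using x y by (simp add: d_def add_assoc scale_closed)
    also have "\<dots> = y" using y d0 by (simp add: add_zero)
    finally show "x = y" .
  qed
  then have JT: "J (T x) = x" if "x \<in> M" for x using that by (simp add: J_def)
  have hilb': "complex_hilbert_space (T ` M) (T zero) (\<lambda>f g. T (add (J f) (J g)))
    (\<lambda>c f. T (scal c (J f))) (\<lambda>f g. inn (J f) (J g))"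
  proof (rule hilbert_transport[OF hilb])
    show "l \<in> M" if "\<And>n. X n \<in> M" "l \<in> H" "(\<lambda>n. dst (X n) l) \<longlonglongrightarrow> 0" for X l
      using that limit_orthogonal[of X l] by (auto simp: M_def)
    show "J (T x) = x" if "x \<in> M" for x using that by (rule JT)
  qed (auto simp: M_def zero_closed add_closed scale_closed inn_zero inn_add inn_scale)
  have nrm': "complex_inner_space.nrm (\<lambda>f g. inn (J f) (J g)) f = nrm (J f)" for f
    using complex_inner_space.nrm_def[OF complex_hilbert_space.axioms(1)[OF hilb']]
    by (simp add: nrm_def)
  have "cnp_representation \<Omega> K (T ` M) (\<lambda>f g. inn (J f) (J g)) (\<lambda>z. T (b z)) \<delta>"
    using rep bM by (auto simp: cnp_representation_def nrm' JT)
  with hilb' assms(1,2) show ?thesis unfolding cnp_kernel_def by blast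
qed

end

(*
  For a CNP kernel K the matrix 1/K(z,w) is congruent to 1 - <b(z),b(w)>, which has one positive
  direction; so its quadratic form is nonpositive on weights orthogonal to a base point.
  Composing phi with the disk automorphism that sends phi(0) to 0 gives psi with psi(0) = 0, and
  up to congruence 1/K becomes (1 - z cnj w)^2 / (1 - psi(z) cnj(psi(w))). Testing it on the points
  0, r, -r with weights -2, 1, 1 and letting r tend to 0, the coefficient of r^4 yields
  (1 - |psi'(0)|^2)^2 <= 0. By the Schwarz lemma psi is a rotation, so phi is a Moebius map.
  Conversely, for a Moebius map one factor 1 - z cnj w cancels, leaving a rescaled Szego kernel.
*)
theory Submission
  imports Defs
begin

section \<open>The complex plane as a Hilbert space, and positivity of rescaled Szego
  kernels\<close>

lemma complex_hilbert_space_complex: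
  "complex_hilbert_space (UNIV :: complex set) 0 (+) (*) (\<lambda>x y. x * cnj y)"
proof -
  have nonneg: "x * cnj x \<in> \<real>\<^sub>\<ge>\<^sub>0" for x
    by (simp flip: complex_norm_square of_real_power)
  interpret complex_inner_space "UNIV :: complex set" 0 "(+)" "(*)" "\<lambda>x y. x * cnj y"
    by unfold_locales (auto simp: algebra_simps intro: nonneg)
  have "nrm x = norm x" for x
    by (simp add: nrm_def cmod_def power2_eq_square)
  then have dst: "dst x y = dist x y" for x y
    by (simp add: dst_def dist_norm)
  show ?thesis
  proof (unfold_locales, goal_cases)
    case (1 X)
    then have "Cauchy X"
      by (auto simp: Cauchy_def dst)
    then obtain l where "X \<longlonglongrightarrow> l"
      using Cauchy_convergent[of X] unfolding convergent_def by blast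
    then have "(\<lambda>n. dst (X n) l) \<longlonglongrightarrow> 0"
      unfolding dst by (rule tendsto_dist_iff[THEN iffD1])
    then show ?case by blast
  qed
qed

text \<open>Expanding \<open>1 / (1 - z * cnj w)\<close> as a geometric series splits the quadratic
  form into the squared moduli of the sums of \<open>d z * z ^ n\<close>. The partial sums are
  therefore nonnegative reals, and this set is closed under limits.\<close>

lemma psd_kernel_szego:
  "psd_kernel (ball 0 1) (\<lambda>z w. \<delta> z * cnj (\<delta> w) / (1 - z * cnj w))"
  unfolding psd_kernel_def
proof (intro allI impI)
  fix F :: "complex set" and c
  assume F: "finite F \<and> F \<subseteq> ball 0 1"
  define d where "d = (\<lambda>z. cnj (c z) * \<delta> z)"
  define f where "f = (\<lambda>n. \<Sum>z\<in>F. \<Sum>w\<in>F. d z * cnj (d w) * (z * cnj w) ^ n)"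
  have "f sums (\<Sum>z\<in>F. \<Sum>w\<in>F. d z * cnj (d w) * (1 / (1 - z * cnj w)))"
    unfolding f_def
  proof (intro sums_sum sums_mult geometric_sums)
    fix z w assume "z \<in> F" "w \<in> F"
    then have "norm z < 1" "norm w < 1" using F by auto
    then show "norm (z * cnj w) < 1"
      using norm_mult_less[of z 1 "cnj w" 1] by simp
  qed
  then have lim: "(\<lambda>N. \<Sum>n<N. f n)
      \<longlonglongrightarrow> (\<Sum>z\<in>F. \<Sum>w\<in>F. d z * cnj (d w) * (1 / (1 - z * cnj w)))"
    by (simp add: sums_def)
  have "f n = of_real ((norm (\<Sum>z\<in>F. d z * z ^ n))\<^sup>2)" for n
    by (simp add: f_def complex_norm_square sum_product power_mult_distrib mult_ac
        del: of_real_power)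
  then have "(\<Sum>n<N. f n) = of_real (\<Sum>n<N. (norm (\<Sum>z\<in>F. d z * z ^ n))\<^sup>2)" for N
    by simp
  then have "(\<Sum>n<N. f n) \<in> \<real>\<^sub>\<ge>\<^sub>0" for N
    by (simp only: nonneg_Reals_of_real_iff) (simp add: sum_nonneg)
  then have "(\<Sum>z\<in>F. \<Sum>w\<in>F. d z * cnj (d w) * (1 / (1 - z * cnj w))) \<in> \<real>\<^sub>\<ge>\<^sub>0"
    by (rule closed_sequentially[OF closed_nonneg_Reals_complex _ lim])
  then show "(\<Sum>z\<in>F. \<Sum>w\<in>F. cnj (c z) * c w * (\<delta> z * cnj (\<delta> w) / (1 - z * cnj w))) \<in> \<real>\<^sub>\<ge>\<^sub>0"
    by (simp add: d_def mult_ac)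
qed

section \<open>The quadratic form of the pointwise inverse of a CNP kernel\<close>

text \<open>The witness is the vector sum of the \<open>scal (d z) (b z)\<close>, built by induction
  because \<open>add\<close> is an abstract operation. Its inner products are all that the form
  computation needs.\<close>

lemma (in complex_inner_space) linear_combination_exists:
  assumes "finite S" and "\<And>z. z \<in> S \<Longrightarrow> b z \<in> H"
  shows "\<exists>v\<in>H. \<forall>y\<in>H. inn v y = (\<Sum>z\<in>S. d z * inn (b z) y)"
  using assms
proof (induction S rule: finite_induct)
  case empty
  then show ?case using zero_closed inn_zero by auto
next
  case (insert z S)
  then obtain v where "v \<in> H" "\<forall>y\<in>H. inn v y = (\<Sum>z\<in>S. d z * inn (b z) y)" by auto
  with insert show ?case
    by (intro bexI[of _ "add (scal (d z) (b z)) v"])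
       (auto simp: inn_add inn_scale scale_closed add_closed)
qed

text \<open>A reversed Cauchy-Schwarz inequality for the form with matrix \<open>1 - inn (b z) (b w)\<close>.\<close>
lemma cnp_kernel_inverse_nonpos:
  assumes cnp: "cnp_kernel \<Omega> K" and S: "finite S" "S \<subseteq> \<Omega>" and w0: "w0 \<in> \<Omega>"
    and orth: "(\<Sum>z\<in>S. e z / K z w0) = 0"
  shows "Re (\<Sum>z\<in>S. \<Sum>w\<in>S. e z * cnj (e w) / K z w) \<le> 0"
proof -
  obtain H :: "('a \<Rightarrow> complex) set" and zero add scal inn b \<delta>
    where hilb: "complex_hilbert_space H zero add scal inn"
      and rep: "cnp_representation \<Omega> K H inn b \<delta>"
    using cnp unfolding cnp_kernel_def by blast
  interpret complex_hilbert_space H zero add scal inn by (rule hilb)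
  have b: "b z \<in> H" "nrm (b z) < 1" "\<delta> z \<noteq> 0" if "z \<in> \<Omega>" for z
    using rep that unfolding cnp_representation_def by auto
  have K: "K z w = \<delta> z * cnj (\<delta> w) / (1 - inn (b z) (b w))" if "z \<in> \<Omega>" "w \<in> \<Omega>" for z w
    using rep that unfolding cnp_representation_def by auto
  \<comment> \<open>Absorbing \<open>\<delta>\<close> into the weights turns
    \<open>e z * cnj (e w) / K z w\<close> into
    \<open>d z * cnj (d w) * (1 - inn (b z) (b w))\<close>. The form becomes
    \<open>|q|^2 - |v|^2\<close>, where \<open>v\<close> is the combination of the
    \<open>b z\<close> with coefficients \<open>d z\<close>.\<close>
  define d where "d = (\<lambda>z. e z / \<delta> z)"
  define q where "q = (\<Sum>z\<in>S. d z)"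
  obtain v where v: "v \<in> H" and inn_v: "\<And>y. y \<in> H \<Longrightarrow> inn v y = (\<Sum>z\<in>S. d z * inn (b z) y)"
    using linear_combination_exists[of S b d] S b by blast
  have "(\<Sum>z\<in>S. e z / K z w0) = (\<Sum>z\<in>S. d z * (1 - inn (b z) (b w0)) / cnj (\<delta> w0))"
    using S w0 K by (intro sum.cong) (auto simp: d_def subset_iff)
  also have "\<dots> = (q - inn v (b w0)) / cnj (\<delta> w0)"
    using inn_v[OF b(1)[OF w0]]
    by (simp add: q_def sum_subtractf right_diff_distrib flip: sum_divide_distrib)
  \<comment> \<open>Orthogonality to \<open>w0\<close> exhibits \<open>q\<close> as an inner product
    with a vector of norm below 1, so Cauchy-Schwarz bounds it by the norm of
    \<open>v\<close>.\<close>
  finally have q: "q = inn v (b w0)"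
    using orth b(3)[OF w0] by simp
  have "cmod q \<le> nrm v * nrm (b w0)"
    unfolding q by (rule cauchy_schwarz) (use v b w0 in auto)
  also have "\<dots> \<le> nrm v"
    using b(2)[OF w0] nrm_nonneg[OF v] by (simp add: mult_left_le)
  finally have le: "(cmod q)\<^sup>2 \<le> (nrm v)\<^sup>2"
    by (simp add: power_mono)
  have "inn v v = (\<Sum>z\<in>S. d z * inn (b z) v)"
    by (rule inn_v[OF v])
  also have "\<dots> = (\<Sum>z\<in>S. \<Sum>w\<in>S. d z * cnj (d w) * inn (b z) (b w))"
  proof (rule sum.cong[OF refl])
    fix z assume z: "z \<in> S"
    then have zH: "b z \<in> H" using S b by blast
    have "inn (b z) v = cnj (inn v (b z))"
      using v zH by (rule inn_commute)
    also have "\<dots> = (\<Sum>w\<in>S. cnj (d w) * inn (b z) (b w))"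
      unfolding inn_v[OF zH] cnj_sum
    proof (rule sum.cong[OF refl])
      fix w assume "w \<in> S"
      then have "b w \<in> H" using S b by blast
      then show "cnj (d w * inn (b w) (b z)) = cnj (d w) * inn (b z) (b w)"
        using inn_commute[of "b w" "b z"] zH by simp
    qed
    finally show "d z * inn (b z) v = (\<Sum>w\<in>S. d z * cnj (d w) * inn (b z) (b w))"
      by (simp add: sum_distrib_left mult_ac)
  qed
  finally have vv: "inn v v = (\<Sum>z\<in>S. \<Sum>w\<in>S. d z * cnj (d w) * inn (b z) (b w))" .
  have "(\<Sum>z\<in>S. \<Sum>w\<in>S. e z * cnj (e w) / K z w)
      = (\<Sum>z\<in>S. \<Sum>w\<in>S. d z * cnj (d w) - d z * cnj (d w) * inn (b z) (b w))"
    using S K by (intro sum.cong) (auto simp: d_def subset_iff algebra_simps diff_divide_distrib)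
  also have "\<dots> = q * cnj q - inn v v"
    unfolding vv by (simp add: q_def sum_subtractf sum_product)
  also have "\<dots> = of_real ((cmod q)\<^sup>2 - (nrm v)\<^sup>2)"
    by (simp only: of_real_diff complex_norm_square inn_self[OF v])
  finally show ?thesis using le by simp
qed

section \<open>The Moebius identity, and CNP kernels from Moebius maps\<close>

text \<open>The variables \<open>a'\<close> and \<open>w\<close> stand for conjugates, which makes
  this pure field algebra. It serves both for points of the disk and, in the converse direction, for
  values of \<open>\<phi>\<close>.\<close>

lemma moebius_identity:
  fixes a a' z w :: "'a :: field"
  assumes "1 - a' * z \<noteq> 0" "1 - a * w \<noteq> 0"
  shows "1 - (a - z) * (a' - w) / ((1 - a' * z) * (1 - a * w))
    = (1 - a * a') * (1 - z * w) / ((1 - a' * z) * (1 - a * w))"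
proof -
  have "(1 - a' * z) * (1 - a * w) - (a - z) * (a' - w) = (1 - a * a') * (1 - z * w)"
    by (simp add: algebra_simps)
  moreover have "(1 - a' * z) * (1 - a * w) / ((1 - a' * z) * (1 - a * w)) = 1"
    using assms by (intro divide_self no_zero_divisors)
  ultimately show ?thesis
    using diff_divide_distrib[of "(1 - a' * z) * (1 - a * w)" "(a - z) * (a' - w)"
        "(1 - a' * z) * (1 - a * w)"]
    by (simp only:)
qed

text \<open>A one-dimensional representation is enough: the Hilbert space is the complex plane and
  \<open>b\<close> is the identity.\<close>

lemma cnp_kernel_moebius:
  assumes "moebius_map \<phi>"
  shows "cnp_kernel (ball 0 1) (sub_bergman_kernel \<phi>)"
proof -
  obtain \<zeta> a where \<zeta>: "norm \<zeta> = 1" and a: "norm a < 1"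
    and \<phi>: "\<And>z. norm z < 1 \<Longrightarrow> \<phi> z = \<zeta> * ((a - z) / (1 - cnj a * z))"
    using assms unfolding moebius_map_def by auto
  have ne: "1 - x * y \<noteq> 0" if "norm x < 1" "norm y < 1" for x y :: complex
    using norm_mult_less[OF that] by auto
  \<comment> \<open>This is the Szego kernel at \<open>a\<close>, normalised in the Hardy space. The
    product \<open>\<delta> z * cnj (\<delta> w)\<close> is exactly the factor left by the Moebius
    identity beside \<open>1 - z * cnj w\<close>.\<close>
  define \<delta> where "\<delta> = (\<lambda>z. of_real (sqrt (1 - (norm a)\<^sup>2)) / (1 - cnj a * z))"
  have a2: "(norm a)\<^sup>2 < 1" using a by (simp add: power_less_one_iff)
  have aa: "of_real (sqrt (1 - (norm a)\<^sup>2)) * of_real (sqrt (1 - (norm a)\<^sup>2)) = 1 - a * cnj a"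
    using a2 by (simp flip: of_real_mult add: complex_norm_square del: of_real_power)
  have \<delta>0: "\<delta> z \<noteq> 0" if "norm z < 1" for z
    using a2 ne[of "cnj a" z] a that by (simp add: \<delta>_def)
  have K: "sub_bergman_kernel \<phi> z w = \<delta> z * cnj (\<delta> w) / (1 - z * cnj w)"
    if z: "norm z < 1" and w: "norm w < 1" for z w
  proof -
    have nz: "1 - cnj a * z \<noteq> 0" "1 - a * cnj w \<noteq> 0" "1 - z * cnj w \<noteq> 0"
      using ne a z w by simp_all
    have \<zeta>\<zeta>: "\<zeta> * cnj \<zeta> = 1"
      using \<zeta> by (metis complex_norm_square of_real_1 power_one)
    have "\<phi> z * cnj (\<phi> w)
        = (\<zeta> * cnj \<zeta>) * ((a - z) * (cnj a - cnj w) / ((1 - cnj a * z) * (1 - a * cnj w)))"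
      using z w by (simp add: \<phi>)
    also have "1 - \<dots> = (1 - a * cnj a) * (1 - z * cnj w) / ((1 - cnj a * z) * (1 - a * cnj w))"
      unfolding \<zeta>\<zeta> mult_1 using nz by (intro moebius_identity)
    also have "\<dots> = \<delta> z * cnj (\<delta> w) * (1 - z * cnj w)"
      by (simp add: \<delta>_def flip: aa)
    finally show ?thesis
      using nz(3) by (simp add: sub_bergman_kernel_def power2_eq_square)
  qed
  show ?thesis
  proof (rule cnp_kernelI[OF _ _ complex_hilbert_space_complex])
    have "psd_kernel (ball 0 1) (\<lambda>z w. \<delta> z * cnj (\<delta> w) / (1 - z * cnj w))"
      by (rule psd_kernel_szego)
    moreover have "(\<Sum>z\<in>F. \<Sum>w\<in>F. cnj (c z) * c w * sub_bergman_kernel \<phi> z w) =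
        (\<Sum>z\<in>F. \<Sum>w\<in>F. cnj (c z) * c w * (\<delta> z * cnj (\<delta> w) / (1 - z * cnj w)))"
      if "F \<subseteq> ball 0 1" for F c
      using that by (intro sum.cong refl) (simp add: K subset_iff)
    ultimately show "psd_kernel (ball 0 1) (sub_bergman_kernel \<phi>)"
      unfolding psd_kernel_def by simp
    show "irreducible_kernel (ball 0 1) (sub_bergman_kernel \<phi>)"
      unfolding irreducible_kernel_def using K \<delta>0 ne by simp
    have "sqrt (Re (z * cnj z)) = norm z" for z
      by (simp add: cmod_def power2_eq_square)
    then show "cnp_representation (ball 0 1) (sub_bergman_kernel \<phi>) UNIV
        (\<lambda>x y. x * cnj y) (\<lambda>z. z) \<delta>"
      unfolding cnp_representation_def
      using K \<delta>0 complex_inner_space.nrm_def[OF complex_hilbert_space.axioms(1)[OF complex_hilbert_space_complex]]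
      by simp
  qed
qed

section \<open>Fourth-order asymptotics of the test form at the origin\<close>

text \<open>Expansion to second order in \<open>u\<close> with an exact remainder, obtained by
  truncating the geometric series of \<open>1 / (1 - u * k)\<close>. In the application
  \<open>u\<close> is \<open>r^2\<close>, and \<open>\<sigma>\<close> is 1 or -1 according to
  whether the two points of the pair agree or are opposite.\<close>

lemma two_point_expansion:
  fixes k :: complex and u \<sigma> :: complex
  assumes "1 - u * k \<noteq> 0" "\<sigma>\<^sup>2 = 1"
  shows "(1 - \<sigma> * u)\<^sup>2 / (1 - u * k) = 1 - 2 * \<sigma> * u + u * k + u\<^sup>2 * (1 - 2 * \<sigma> * k + k\<^sup>2)
    + u\<^sup>2 * (u * (k - 2 * \<sigma> * k\<^sup>2 + u * k\<^sup>2 + (1 - \<sigma> * u)\<^sup>2 * k ^ 3 / (1 - u * k)))"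
proof -
  define x where "x = 1 / (1 - u * k)"
  have "x * (1 - u * k) = 1" using assms(1) by (simp add: x_def)
  then have x: "x = 1 + u * k + u\<^sup>2 * k\<^sup>2 + u ^ 3 * k ^ 3 * x"
    by algebra
  have "(1 - \<sigma> * u)\<^sup>2 = 1 - 2 * \<sigma> * u + u\<^sup>2"
    using assms(2) by algebra
  then have "(1 - \<sigma> * u)\<^sup>2 * x = 1 - 2 * \<sigma> * u + u * k + u\<^sup>2 * (1 - 2 * \<sigma> * k + k\<^sup>2)
    + u\<^sup>2 * (u * (k - 2 * \<sigma> * k\<^sup>2 + u * k\<^sup>2 + (1 - \<sigma> * u)\<^sup>2 * k ^ 3 * x))"
    using x by algebra
  then show ?thesis by (simp add: x_def)
qed

text \<open>
  The hypothesis says that the form of the kernel \<open>(1 - z * cnj w)\<^sup>2 / (1 - \<psi> z * cnj (\<psi> w))\<close> at the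
  points \<open>0, r, - r\<close> with the weights \<open>-2, 1, 1\<close> is nonpositive.
\<close>
lemma norm_deriv_eq_1:
  fixes \<psi> :: "complex \<Rightarrow> complex"
  assumes der: "(\<psi> has_field_derivative c) (at 0)" and \<psi>0: "\<psi> 0 = 0"
    and le: "\<And>r. \<lbrakk>0 < r; r < 1\<rbrakk> \<Longrightarrow>
      Re (\<Sum>x\<in>{of_real r, - of_real r}. \<Sum>y\<in>{of_real r, - of_real r}.
          (1 - x * cnj y)\<^sup>2 / (1 - \<psi> x * cnj (\<psi> y))) \<le> 4"
  shows "norm c = 1"
proof -
  \<comment> \<open>The difference quotients at \<open>r\<close> and \<open>-r\<close> both tend to
    \<open>c\<close>. They are kept apart because \<open>\<psi>\<close> need not be odd.\<close>
  define s where "s = (\<lambda>r::real. \<psi> (of_real r) / of_real r)"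
  define t where "t = (\<lambda>r::real. \<psi> (- of_real r) / (- of_real r))"
  have quot: "((\<lambda>h. \<psi> h / h) \<longlongrightarrow> c) (at 0)"
    using der \<psi>0 by (simp add: has_field_derivative_iff)
  have "filterlim (\<lambda>r::real. of_real r :: complex) (at 0) (at_right 0)"
    unfolding filterlim_at
    by (auto intro!: tendsto_eq_intros simp: eventually_at_right_less eventually_at_filter)
  then have s: "(s \<longlongrightarrow> c) (at_right 0)"
    unfolding s_def by (rule filterlim_compose[OF quot])
  have "filterlim (\<lambda>r::real. - of_real r :: complex) (at 0) (at_right 0)"
    unfolding filterlim_at
    by (auto intro!: tendsto_eq_intros simp: eventually_at_right_less eventually_at_filter)
  then have t: "(t \<longlongrightarrow> c) (at_right 0)"
    unfolding t_def by (rule filterlim_compose[OF quot])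
  define u where "u = (\<lambda>r::real. (of_real r :: complex)\<^sup>2)"
  have u: "(u \<longlongrightarrow> 0) (at_right 0)"
    unfolding u_def by (auto intro!: tendsto_eq_intros)
  \<comment> \<open>The remainder of the expansion divided by \<open>u^2\<close>; it vanishes in the
    limit whenever \<open>k\<close> converges.\<close>
  define R where "R = (\<lambda>\<sigma> k r. u r * (k - 2 * \<sigma> * k\<^sup>2 + u r * k\<^sup>2
      + (1 - \<sigma> * u r)\<^sup>2 * k ^ 3 / (1 - u r * k)))"
  have expansion: "(1 - \<sigma> * u r)\<^sup>2 / (1 - u r * k) = 1 - 2 * \<sigma> * u r + u r * k
      + (u r)\<^sup>2 * (1 - 2 * \<sigma> * k + k\<^sup>2) + (u r)\<^sup>2 * R \<sigma> k r"
    if "1 - u r * k \<noteq> 0" "\<sigma>\<^sup>2 = 1" for \<sigma> k r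
    unfolding R_def using that by (rule two_point_expansion)
  have R: "((\<lambda>r. R \<sigma> (k r) r) \<longlongrightarrow> 0) (at_right 0)" if "(k \<longlongrightarrow> l) (at_right 0)" for \<sigma> k l
    unfolding R_def by (rule tendsto_eq_intros that u refl | simp)+
  have ev: "\<forall>\<^sub>F r in at_right 0. 1 - u r * k r \<noteq> 0" if "(k \<longlongrightarrow> l) (at_right 0)" for k l
  proof -
    have "((\<lambda>r. 1 - u r * k r) \<longlongrightarrow> 1) (at_right 0)"
      by (rule tendsto_eq_intros that u refl | simp)+
    then show ?thesis by (rule tendsto_imp_eventually_ne) simp
  qed
  \<comment> \<open>Chosen so that the real part of the double sum is
    \<open>4 + r^2 * |s - t|^2 + r^4 * Q r\<close>: the terms \<open>- 2 * \<sigma> * u\<close>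
    cancel over the four pairs, and the terms \<open>u * k\<close> combine to the middle
    square.\<close>
  define Q where "Q = (\<lambda>r. 4 - 2 * (norm (s r + t r))\<^sup>2 + (norm ((s r)\<^sup>2 + (t r)\<^sup>2))\<^sup>2
      + Re (R 1 (s r * cnj (s r)) r + R 1 (t r * cnj (t r)) r
        + R (-1) (- (s r * cnj (t r))) r + R (-1) (- (t r * cnj (s r))) r))"
  have "(Q \<longlongrightarrow> 4 - 2 * (norm (c + c))\<^sup>2 + (norm (c\<^sup>2 + c\<^sup>2))\<^sup>2 + Re (0 + 0 + 0 + 0)) (at_right 0)"
    unfolding Q_def
    by (intro tendsto_intros R[where l = "c * cnj c"] R[where l = "- (c * cnj c)"] s t)
  moreover have "\<forall>\<^sub>F r in at_right 0. Q r \<le> 0"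
  proof -
    have "\<forall>\<^sub>F r::real in at_right 0. 0 < r \<and> r < 1"
      by (auto simp: eventually_at_right_field intro: exI[of _ 1])
    moreover have "\<forall>\<^sub>F r in at_right 0. 1 - u r * (s r * cnj (s r)) \<noteq> 0"
      by (rule ev[where l = "c * cnj c"]) (intro tendsto_intros s t)
    moreover have "\<forall>\<^sub>F r in at_right 0. 1 - u r * (t r * cnj (t r)) \<noteq> 0"
      by (rule ev[where l = "c * cnj c"]) (intro tendsto_intros s t)
    moreover have "\<forall>\<^sub>F r in at_right 0. 1 - u r * (- (s r * cnj (t r))) \<noteq> 0"
      by (rule ev[where l = "- (c * cnj c)"]) (intro tendsto_intros s t)
    moreover have "\<forall>\<^sub>F r in at_right 0. 1 - u r * (- (t r * cnj (s r))) \<noteq> 0"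
      by (rule ev[where l = "- (c * cnj c)"]) (intro tendsto_intros s t)
    ultimately show ?thesis
    proof eventually_elim
      case (elim r)
      then have r: "0 < r" "r < 1" by auto
      let ?s = "s r" and ?t = "t r" and ?u = "u r"
      have ps: "\<psi> (of_real r) = of_real r * ?s" and pt: "\<psi> (- of_real r) = - (of_real r * ?t)"
        using r by (simp_all add: s_def t_def)
      have ne: "complex_of_real r \<noteq> - complex_of_real r"
        using r by (simp add: eq_neg_iff_add_eq_0 flip: of_real_add of_real_minus)
      have minus_one: "(- 1 :: complex)\<^sup>2 = 1" by simp
      have "(\<Sum>x\<in>{of_real r, - of_real r}. \<Sum>y\<in>{of_real r, - of_real r}.
          (1 - x * cnj y)\<^sup>2 / (1 - \<psi> x * cnj (\<psi> y)))
        = (1 - 1 * ?u)\<^sup>2 / (1 - ?u * (?s * cnj ?s)) + (1 - 1 * ?u)\<^sup>2 / (1 - ?u * (?t * cnj ?t))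
          + (1 - (-1) * ?u)\<^sup>2 / (1 - ?u * (- (?s * cnj ?t)))
          + (1 - (-1) * ?u)\<^sup>2 / (1 - ?u * (- (?t * cnj ?s)))"
        using ne by (simp add: ps pt u_def power2_eq_square mult_ac)
      also have "\<dots> = 4 + ?u * ((?s - ?t) * cnj (?s - ?t)) + ?u\<^sup>2 *
          (4 - 2 * ((?s + ?t) * cnj (?s + ?t)) + (?s\<^sup>2 + ?t\<^sup>2) * cnj (?s\<^sup>2 + ?t\<^sup>2)
          + (R 1 (?s * cnj ?s) r + R 1 (?t * cnj ?t) r
           + R (-1) (- (?s * cnj ?t)) r + R (-1) (- (?t * cnj ?s)) r))"
        unfolding expansion[OF elim(2) power_one] expansion[OF elim(3) power_one]
          expansion[OF elim(4) minus_one] expansion[OF elim(5) minus_one]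
        by (simp add: algebra_simps power2_eq_square)
      also have "\<dots> = of_real (4 + r\<^sup>2 * (norm (?s - ?t))\<^sup>2) + of_real ((r\<^sup>2)\<^sup>2) *
          (of_real (4 - 2 * (norm (?s + ?t))\<^sup>2 + (norm (?s\<^sup>2 + ?t\<^sup>2))\<^sup>2)
          + (R 1 (?s * cnj ?s) r + R 1 (?t * cnj ?t) r
           + R (-1) (- (?s * cnj ?t)) r + R (-1) (- (?t * cnj ?s)) r))"
        by (simp only: u_def of_real_add of_real_diff of_real_mult of_real_numeral
            complex_norm_square flip: of_real_power)
      finally have "4 + r\<^sup>2 * (norm (?s - ?t))\<^sup>2 + (r\<^sup>2)\<^sup>2 * Q r \<le> 4"
        using le[OF r] by (simp add: Q_def)
      moreover have "0 \<le> r\<^sup>2 * (norm (?s - ?t))\<^sup>2" by simp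
      ultimately have "(r\<^sup>2)\<^sup>2 * Q r \<le> 0" by linarith
      then show "Q r \<le> 0"
        using r by (simp add: mult_le_0_iff)
    qed
  qed
  ultimately have "4 - 2 * (norm (c + c))\<^sup>2 + (norm (c\<^sup>2 + c\<^sup>2))\<^sup>2 + Re (0 + 0 + 0 + 0) \<le> 0"
    by (intro tendsto_upperbound[of Q _ "at_right 0"]) auto
  moreover have "norm (c + c) = 2 * norm c" "norm (c\<^sup>2 + c\<^sup>2) = 2 * (norm c)\<^sup>2"
    by (simp_all flip: mult_2 add: norm_mult norm_power)
  \<comment> \<open>The limit \<open>4 - 8 * |c|^2 + 4 * |c|^4\<close> of \<open>Q\<close> is a
    perfect square.\<close>
  ultimately have "4 * ((norm c)\<^sup>2 - 1)\<^sup>2 \<le> 0"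
    by (simp add: power2_eq_square algebra_simps)
  then have "(norm c)\<^sup>2 = 1"
    by (simp add: mult_le_0_iff)
  then show ?thesis
    by (simp add: power2_eq_1_iff) (metis norm_ge_zero neg_0_le_iff_le not_one_le_zero)
qed

section \<open>CNP kernels force Moebius maps\<close>

lemma moebius_of_cnp_kernel:
  assumes hol: "\<phi> holomorphic_on ball 0 1"
    and bd: "\<And>z. z \<in> ball 0 1 \<Longrightarrow> norm (\<phi> z) \<le> 1"
    and cnp: "cnp_kernel (ball 0 1) (sub_bergman_kernel \<phi>)"
  shows "moebius_map \<phi>"
proof -
  \<comment> \<open>Irreducibility on the diagonal makes the bound strict. This excludes unimodular
    constants and keeps the denominators below nonzero.\<close>
  have lt: "norm (\<phi> z) < 1" if "norm z < 1" for z
  proof -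
    have "sub_bergman_kernel \<phi> z z \<noteq> 0"
      using cnp that unfolding cnp_kernel_def irreducible_kernel_def by simp
    then have "\<phi> z * cnj (\<phi> z) \<noteq> 1"
      by (auto simp: sub_bergman_kernel_def)
    then have "norm (\<phi> z) \<noteq> 1"
      by (metis complex_norm_square of_real_1 power_one)
    then show ?thesis using bd[of z] that by simp
  qed
  have ne: "1 - x * y \<noteq> 0" if "norm x < 1" "norm y < 1" for x y :: complex
    using norm_mult_less[OF that] by auto
  define \<alpha> where "\<alpha> = \<phi> 0"
  define \<psi> where "\<psi> = (\<lambda>z. (\<alpha> - \<phi> z) / (1 - cnj \<alpha> * \<phi> z))"
  have \<alpha>: "norm \<alpha> < 1" using lt[of 0] by (simp add: \<alpha>_def)
  have den: "1 - cnj \<alpha> * \<phi> z \<noteq> 0" if "norm z < 1" for z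
    using ne \<alpha> lt[OF that] by simp
  have \<psi>\<psi>: "1 - \<psi> z * cnj (\<psi> w) = (1 - \<alpha> * cnj \<alpha>) * (1 - \<phi> z * cnj (\<phi> w))
      / ((1 - cnj \<alpha> * \<phi> z) * (1 - \<alpha> * cnj (\<phi> w)))" if "norm z < 1" "norm w < 1" for z w
  proof -
    have "1 - \<alpha> * cnj (\<phi> w) \<noteq> 0" using ne \<alpha> lt[OF that(2)] by simp
    then show ?thesis
      using moebius_identity[OF den[OF that(1)], of \<alpha> "cnj (\<phi> w)"] by (simp add: \<psi>_def)
  qed
  have \<psi>0: "\<psi> 0 = 0" by (simp add: \<psi>_def \<alpha>_def)
  have \<psi>hol: "\<psi> holomorphic_on ball 0 1"
    unfolding \<psi>_def using den by (intro holomorphic_intros hol) auto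
  have \<psi>lt: "norm (\<psi> z) < 1" if z: "norm z < 1" for z
  proof -
    have "of_real (1 - (norm (\<psi> z))\<^sup>2) = 1 - \<psi> z * cnj (\<psi> z)"
      by (simp only: of_real_diff complex_norm_square of_real_1)
    also have "\<dots> = (1 - \<alpha> * cnj \<alpha>) * (1 - \<phi> z * cnj (\<phi> z))
        / ((1 - cnj \<alpha> * \<phi> z) * cnj (1 - cnj \<alpha> * \<phi> z))"
      using \<psi>\<psi>[OF z z] by simp
    also have "\<dots> = of_real ((1 - (norm \<alpha>)\<^sup>2) * (1 - (norm (\<phi> z))\<^sup>2)
        / (norm (1 - cnj \<alpha> * \<phi> z))\<^sup>2)"
      by (simp only: of_real_divide of_real_mult of_real_diff complex_norm_square of_real_1)
    finally have "1 - (norm (\<psi> z))\<^sup>2 = (1 - (norm \<alpha>)\<^sup>2) * (1 - (norm (\<phi> z))\<^sup>2)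
        / (norm (1 - cnj \<alpha> * \<phi> z))\<^sup>2"
      using of_real_eq_iff by blast
    also have "\<dots> > 0"
      using \<alpha> lt[OF z] den[OF z] by (simp add: power_less_one_iff)
    finally have "(norm (\<psi> z))\<^sup>2 < 1" by simp
    then show ?thesis by (simp add: power_less_one_iff)
  qed
  have "norm (deriv \<psi> 0) = 1"
  proof (rule norm_deriv_eq_1)
    show "(\<psi> has_field_derivative deriv \<psi> 0) (at 0)"
      using \<psi>hol by (rule holomorphic_derivI) auto
    show "\<psi> 0 = 0" by (rule \<psi>0)
    fix r :: real assume r: "0 < r" "r < 1"
    define A where "A = {complex_of_real r, - complex_of_real r}"
    have A: "finite A" "0 \<notin> A" "\<And>z. z \<in> A \<Longrightarrow> norm z < 1"
      and cA: "card A = 2"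
      using r by (auto simp: A_def card_insert_if eq_neg_iff_add_eq_0 simp flip: of_real_add of_real_minus)
    have nA: "norm z < 1" if "z \<in> insert 0 A" for z using that A(3) by auto
    \<comment> \<open>The inverse kernel normalised at 0: by the Moebius identity it agrees with
      \<open>1 / K\<close> up to a congruence and the positive constant \<open>m\<close>, and it
      equals 1 when either argument is 0.\<close>
    define L where "L = (\<lambda>z w. (1 - z * cnj w)\<^sup>2 / (1 - \<psi> z * cnj (\<psi> w)))"
    define m where "m = 1 - \<alpha> * cnj \<alpha>"
    have m: "m \<noteq> 0" using ne[of \<alpha> "cnj \<alpha>"] \<alpha> by (simp add: m_def)
    \<comment> \<open>Since \<open>L z 0 = 1\<close>, orthogonality to the base point 0 says that
      the weights sum to zero. The weights \<open>e\<close> carry the congruence factor as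
      well.\<close>
    define h where "h = (\<lambda>z::complex. if z = 0 then - 2 else (1::complex))"
    define e where "e = (\<lambda>z. h z * (1 - cnj \<alpha> * \<phi> z))"
    have K: "(1 - cnj \<alpha> * \<phi> z) * (1 - \<alpha> * cnj (\<phi> w)) / sub_bergman_kernel \<phi> z w = m * L z w"
      if "norm z < 1" "norm w < 1" for z w
      using m unfolding sub_bergman_kernel_def L_def \<psi>\<psi>[OF that] m_def by simp
    have L0: "L z 0 = 1" "L 0 z = 1" for z by (simp_all add: L_def \<psi>0)
    have orth: "(\<Sum>z\<in>insert 0 A. e z / sub_bergman_kernel \<phi> z 0) = 0"
    proof -
      have "e z / sub_bergman_kernel \<phi> z 0 = h z" if "z \<in> insert 0 A" for z
      proof -
        \<comment> \<open>At \<open>w = 0\<close> the second congruence factor is \<open>m\<close>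
          itself, because \<open>\<phi> 0 = \<alpha>\<close>.\<close>
        have "m * ((1 - cnj \<alpha> * \<phi> z) / sub_bergman_kernel \<phi> z 0) = m * 1"
          using K[of z 0] nA[OF that] unfolding L0 m_def \<alpha>_def by (simp add: mult.commute)
        then have "(1 - cnj \<alpha> * \<phi> z) / sub_bergman_kernel \<phi> z 0 = 1"
          using m unfolding mult_cancel_left by blast
        then have "h z * ((1 - cnj \<alpha> * \<phi> z) / sub_bergman_kernel \<phi> z 0) = h z"
          by simp
        then show ?thesis by (simp add: e_def h_def)
      qed
      then have "(\<Sum>z\<in>insert 0 A. e z / sub_bergman_kernel \<phi> z 0) = (\<Sum>z\<in>insert 0 A. h z)"
        by simp
      also have "\<dots> = -2 + (\<Sum>z\<in>A. 1)"
      proof -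
        have "(\<Sum>z\<in>A. h z) = (\<Sum>z\<in>A. 1)"
          using A(2) by (intro sum.cong) (auto simp: h_def)
        then show ?thesis using A(1,2) by (simp add: h_def)
      qed
      finally show ?thesis using cA by simp
    qed
    have "Re (\<Sum>z\<in>insert 0 A. \<Sum>w\<in>insert 0 A. e z * cnj (e w) / sub_bergman_kernel \<phi> z w) \<le> 0"
      by (rule cnp_kernel_inverse_nonpos[OF cnp _ _ _ orth]) (use nA A in auto)
    also have "(\<Sum>z\<in>insert 0 A. \<Sum>w\<in>insert 0 A. e z * cnj (e w) / sub_bergman_kernel \<phi> z w)
        = (\<Sum>z\<in>insert 0 A. \<Sum>w\<in>insert 0 A. m * (h z * h w * L z w))"
    proof (intro sum.cong refl)
      fix z w assume "z \<in> insert 0 A" "w \<in> insert 0 A"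
      then have "m * L z w = (1 - cnj \<alpha> * \<phi> z) * (1 - \<alpha> * cnj (\<phi> w)) / sub_bergman_kernel \<phi> z w"
        using K nA by simp
      moreover have "e z * cnj (e w) / sub_bergman_kernel \<phi> z w = h z * h w *
          ((1 - cnj \<alpha> * \<phi> z) * (1 - \<alpha> * cnj (\<phi> w)) / sub_bergman_kernel \<phi> z w)"
        by (simp add: e_def h_def)
      ultimately have "e z * cnj (e w) / sub_bergman_kernel \<phi> z w = h z * h w * (m * L z w)"
        by (simp only:)
      then show "e z * cnj (e w) / sub_bergman_kernel \<phi> z w = m * (h z * h w * L z w)"
        by (simp only: mult_ac)
    qed
    also have "\<dots> = m * (\<Sum>z\<in>insert 0 A. \<Sum>w\<in>insert 0 A. h z * h w * L z w)"
      by (simp only: sum_distrib_left)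
    \<comment> \<open>The pair \<open>(0, 0)\<close> contributes 4 and the four mixed pairs
      contribute -2 each, which gives the constant -4.\<close>
    also have "(\<Sum>z\<in>insert 0 A. \<Sum>w\<in>insert 0 A. h z * h w * L z w)
        = (\<Sum>z\<in>A. \<Sum>w\<in>A. L z w) - 4"
    proof -
      have h: "h 0 = -2" "\<And>z. z \<in> A \<Longrightarrow> h z = 1" using A by (auto simp: h_def)
      show ?thesis
        using A(1,2) cA by (simp add: L0 h sum.distrib sum_subtractf)
    qed
    also have "m = of_real (1 - (norm \<alpha>)\<^sup>2)"
      by (simp only: m_def of_real_diff of_real_1 complex_norm_square)
    finally have "(1 - (norm \<alpha>)\<^sup>2) * (Re (\<Sum>z\<in>A. \<Sum>w\<in>A. L z w) - 4) \<le> 0"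
      by simp
    moreover have "1 - (norm \<alpha>)\<^sup>2 > 0"
      using \<alpha> by (simp add: power_less_one_iff)
    ultimately have "Re (\<Sum>z\<in>A. \<Sum>w\<in>A. L z w) \<le> 4"
      by (simp add: mult_le_0_iff)
    then show "Re (\<Sum>x\<in>{of_real r, - of_real r}. \<Sum>y\<in>{of_real r, - of_real r}.
          (1 - x * cnj y)\<^sup>2 / (1 - \<psi> x * cnj (\<psi> y))) \<le> 4"
      unfolding A_def L_def .
  qed
  \<comment> \<open>The equality case of the Schwarz lemma.\<close>
  then obtain \<beta> where \<beta>: "norm \<beta> = 1" "\<And>z. norm z < 1 \<Longrightarrow> \<psi> z = \<beta> * z"
    using Schwarz_Lemma(3)[OF \<psi>hol \<psi>0 \<psi>lt, of 0] by auto
  have \<beta>\<beta>: "\<beta> * cnj \<beta> = 1"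
    using \<beta>(1) by (metis complex_norm_square of_real_1 power_one)
  \<comment> \<open>The automorphism exchanging \<open>\<alpha>\<close> and 0 is its own inverse, so
    \<open>\<phi>\<close> is that automorphism applied to \<open>\<beta> * z\<close>. Extracting
    \<open>\<beta>\<close> from the numerator moves the zero to
    \<open>\<alpha> * cnj \<beta>\<close>.\<close>
  have "\<phi> z = \<beta> * ((\<alpha> * cnj \<beta> - z) / (1 - cnj (\<alpha> * cnj \<beta>) * z))" if z: "norm z < 1" for z
  proof -
    have nz: "1 - cnj \<alpha> * (\<beta> * z) \<noteq> 0"
      using ne[of "cnj \<alpha>" "\<beta> * z"] \<alpha> \<beta>(1) z by (simp add: norm_mult)
    have "\<beta> * z * (1 - cnj \<alpha> * \<phi> z) = \<alpha> - \<phi> z"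
      using \<beta>(2)[OF z] den[OF z] by (simp add: \<psi>_def field_simps)
    then have "\<phi> z * (1 - cnj \<alpha> * (\<beta> * z)) = \<alpha> - \<beta> * z"
      by (simp add: algebra_simps)
    then have "\<phi> z = (\<alpha> * (\<beta> * cnj \<beta>) - \<beta> * z) / (1 - cnj \<alpha> * (\<beta> * z))"
      using nz by (simp add: field_simps \<beta>\<beta>)
    then show ?thesis by (simp add: algebra_simps)
  qed
  moreover have "\<alpha> * cnj \<beta> \<in> ball 0 1"
    using \<alpha> \<beta>(1) by (simp add: norm_mult)
  ultimately show ?thesis
    unfolding moebius_map_def using \<beta>(1) by (intro exI[of _ \<beta>] exI[of _ "\<alpha> * cnj \<beta>"]) simp
qed

theorem theorem4:
  fixes \<phi> :: "complex \<Rightarrow> complex"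
  assumes "\<phi> analytic_on ball 0 1"
    and "\<And>z. z \<in> ball 0 1 \<Longrightarrow> norm (\<phi> z) \<le> 1"
  shows "cnp_kernel (ball 0 1) (sub_bergman_kernel \<phi>) \<longleftrightarrow> moebius_map \<phi>"
  using assms cnp_kernel_moebius moebius_of_cnp_kernel analytic_imp_holomorphic by blast

end
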